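(* Let $L$ be a frame and $N(L)$ the frame of nuclei on $L$. There is a bijection between the set $\mathsf{pt}(L)$ of points of $L$ and the set $\mathsf{pt}(N(L))$ of points of $N(L)$.
   Context: A frame is a complete lattice satisfying $a\wedge\bigvee S=\bigvee\{a\wedge s\mid s\in S\}$. A frame homomorphism is a map preserving finite meets and arbitrary joins. A point of a frame $L$ is a frame homomorphism $L\to\mathsf{2}$, where $\mathsf{2}=\{0,1\}$ is the two-element frame; points correspond bijectively to completely prime filters of $L$ and to meet-prime elements of $L$. $\mathsf{pt}(L)$ is the set of points of $L$. A nucleus on $L$ is a map $j:L\to L$ with $a\le ja$, $jja\le ja$, and $j(a\wedge b)=ja\wedge jb$ for all $a,b\in L$. $N(L)$ is the set of all nuclei on $L$ ordered by $j\le k$ iff $ja\le ka$ for all $a\in L$; it is a frame. *)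

theory Defs
  imports Main
begin

class frame = complete_lattice +
  assumes inf_Sup_frame: "inf a (Sup S) = (SUP s\<in>S. inf a s)"

instance bool :: frame
  by standard (rule inf_Sup)

definition frame_hom :: "('a::frame \<Rightarrow> 'b::frame) \<Rightarrow> bool" where
  "frame_hom f \<longleftrightarrow>
     (\<forall>A. finite A \<longrightarrow> f (Inf A) = Inf (f ` A)) \<and> (\<forall>S. f (Sup S) = Sup (f ` S))"

text \<open>The two-element frame is \<^typ>\<open>bool\<close>, ordered by \<^prop>\<open>False \<le> True\<close>.\<close>

definition pt :: "('a::frame \<Rightarrow> bool) set" where
  "pt = {p. frame_hom p}"

definition is_nucleus :: "('a::frame \<Rightarrow> 'a) \<Rightarrow> bool" where
  "is_nucleus j \<longleftrightarrow>
     (\<forall>a. a \<le> j a) \<and> (\<forall>a. j (j a) \<le> j a) \<and> (\<forall>a b. j (inf a b) = inf (j a) (j b))"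

lemma is_nucleusI:
  assumes "\<And>a. a \<le> j a" "\<And>a. j (j a) \<le> j a" "\<And>a b. a \<le> b \<Longrightarrow> j a \<le> j b"
    "\<And>a b. inf (j a) (j b) \<le> j (inf a b)"
  shows "is_nucleus j"
  unfolding is_nucleus_def using assms by (auto intro!: antisym)

lemma is_nucleus_mono: "is_nucleus j \<Longrightarrow> a \<le> b \<Longrightarrow> j a \<le> j b"
  unfolding is_nucleus_def by (metis inf.absorb_iff2 inf.commute le_iff_inf)

typedef (overloaded) 'a nucleus = "{j :: 'a::frame \<Rightarrow> 'a. is_nucleus j}"
  morphisms app_nucleus Nucleus
  by (rule exI[of _ id]) (simp add: is_nucleus_def)

setup_lifting type_definition_nucleus

instantiation nucleus :: (frame) order
begin

lift_definition less_eq_nucleus :: "'a nucleus \<Rightarrow> 'a nucleus \<Rightarrow> bool"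
  is "\<lambda>j k. \<forall>a. j a \<le> k a" .

definition less_nucleus :: "'a nucleus \<Rightarrow> 'a nucleus \<Rightarrow> bool" where
  "less_nucleus j k \<longleftrightarrow> j \<le> k \<and> \<not> k \<le> j"

instance
proof
  fix x y z :: "'a nucleus"
  show "x < y \<longleftrightarrow> x \<le> y \<and> \<not> y \<le> x" by (rule less_nucleus_def)
  show "x \<le> x" by transfer simp
  show "x \<le> y \<Longrightarrow> y \<le> z \<Longrightarrow> x \<le> z" by transfer (blast intro: order_trans)
  show "x \<le> y \<Longrightarrow> y \<le> x \<Longrightarrow> x = y" by transfer (auto intro: antisym)
qed

end

lemma is_nucleus_INF:
  assumes "\<And>j. j \<in> A \<Longrightarrow> is_nucleus j"
  shows "is_nucleus (\<lambda>a. INF j\<in>A. j a)"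
proof (rule is_nucleusI)
  fix a b :: 'a
  show "a \<le> (INF j\<in>A. j a)"
    using assms by (auto intro!: INF_greatest simp: is_nucleus_def)
  show "(INF j\<in>A. j a) \<le> (INF j\<in>A. j b)" if "a \<le> b"
    by (rule INF_mono) (use is_nucleus_mono[OF assms that] in blast)
  show "(INF j\<in>A. j (INF k\<in>A. k a)) \<le> (INF j\<in>A. j a)"
  proof (rule INF_greatest)
    fix j assume j: "j \<in> A"
    have "(INF j\<in>A. j (INF k\<in>A. k a)) \<le> j (INF k\<in>A. k a)" using j by (rule INF_lower)
    also have "\<dots> \<le> j (j a)"
      by (rule is_nucleus_mono[OF assms[OF j] INF_lower[OF j]])
    also have "\<dots> \<le> j a" using assms[OF j] by (simp add: is_nucleus_def)
    finally show "(INF j\<in>A. j (INF k\<in>A. k a)) \<le> j a" .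
  qed
  show "inf (INF j\<in>A. j a) (INF j\<in>A. j b) \<le> (INF j\<in>A. j (inf a b))"
  proof (rule INF_greatest)
    fix j assume j: "j \<in> A"
    have "inf (INF j\<in>A. j a) (INF j\<in>A. j b) \<le> inf (j a) (j b)"
      by (rule inf_mono) (rule INF_lower[OF j])+
    then show "inf (INF j\<in>A. j a) (INF j\<in>A. j b) \<le> j (inf a b)"
      using assms[OF j] by (simp add: is_nucleus_def)
  qed
qed

instantiation nucleus :: (frame) complete_lattice
begin

lift_definition Inf_nucleus :: "'a nucleus set \<Rightarrow> 'a nucleus"
  is "\<lambda>A a. INF j\<in>A. j a" by (rule is_nucleus_INF) auto

definition Sup_nucleus :: "'a nucleus set \<Rightarrow> 'a nucleus" where
  "Sup_nucleus A = Inf {k. \<forall>j\<in>A. j \<le> k}"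

definition inf_nucleus :: "'a nucleus \<Rightarrow> 'a nucleus \<Rightarrow> 'a nucleus" where
  "inf_nucleus j k = Inf {j, k}"

definition sup_nucleus :: "'a nucleus \<Rightarrow> 'a nucleus \<Rightarrow> 'a nucleus" where
  "sup_nucleus j k = Sup {j, k}"

definition bot_nucleus :: "'a nucleus" where
  "bot_nucleus = Sup {}"

definition top_nucleus :: "'a nucleus" where
  "top_nucleus = Inf {}"

instance
proof
  have lower: "Inf A \<le> x" if "x \<in> A" for A and x :: "'a nucleus"
    using that by transfer (auto intro: INF_lower)
  have greatest: "z \<le> Inf A" if "\<And>x. x \<in> A \<Longrightarrow> z \<le> x" for A and z :: "'a nucleus"
    using that by transfer (auto intro: INF_greatest)
  fix x y z :: "'a nucleus" and A :: "'a nucleus set"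
  show "x \<in> A \<Longrightarrow> Inf A \<le> x" by (rule lower)
  show "(\<And>x. x \<in> A \<Longrightarrow> z \<le> x) \<Longrightarrow> z \<le> Inf A" by (rule greatest)
  show "x \<in> A \<Longrightarrow> x \<le> Sup A" by (auto simp: Sup_nucleus_def intro: greatest)
  show "(\<And>x. x \<in> A \<Longrightarrow> x \<le> z) \<Longrightarrow> Sup A \<le> z" by (auto simp: Sup_nucleus_def intro: lower)
  show "inf x y \<le> x" "inf x y \<le> y" by (auto simp: inf_nucleus_def intro: lower)
  show "x \<le> y \<Longrightarrow> x \<le> z \<Longrightarrow> x \<le> inf y z" by (auto simp: inf_nucleus_def intro: greatest)
  show "x \<le> sup x y" "y \<le> sup x y"
    by (auto simp: sup_nucleus_def Sup_nucleus_def intro: greatest)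
  show "y \<le> x \<Longrightarrow> z \<le> x \<Longrightarrow> sup y z \<le> x"
    by (auto simp: sup_nucleus_def Sup_nucleus_def intro: lower)
  show "Inf {} = (top :: 'a nucleus)" by (simp add: top_nucleus_def)
  show "Sup {} = (bot :: 'a nucleus)" by (simp add: bot_nucleus_def)
qed

end

lemma app_inf_nucleus: "app_nucleus (inf j k) a = inf (app_nucleus j a) (app_nucleus k a)"
  unfolding inf_nucleus_def by transfer simp

lemma frame_sup_inf_distrib: "inf (sup a c) (sup b c) \<le> sup (inf a b) (c :: 'a::frame)"
proof -
  have d: "inf x (sup y z) = sup (inf x y) (inf x z)" for x y z :: 'a
    using inf_Sup_frame[of x "{y, z}"] by simp
  have "inf (sup a c) (sup b c) = sup (inf b (sup a c)) (inf c (sup a c))"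
    using d[of "sup a c" b c] by (simp add: inf.commute)
  also have "\<dots> \<le> sup (inf a b) c"
    by (simp add: d inf.commute le_supI1 le_supI2)
  finally show ?thesis .
qed

text \<open>The function below is the Heyting implication of \<open>j\<close> and \<open>k\<close> in the frame of nuclei.\<close>

lemma is_nucleus_imp:
  fixes j k :: "'a::frame \<Rightarrow> 'a"
  assumes j: "is_nucleus j" and k: "is_nucleus k"
  defines "h \<equiv> \<lambda>a. Sup {z. \<forall>b\<ge>a. inf z (j b) \<le> k b}"
  shows "is_nucleus h" and "\<And>a. inf (j a) (h a) \<le> k a"
proof -
  note J = j[unfolded is_nucleus_def] and K = k[unfolded is_nucleus_def]
  have le_h: "z \<le> h a" if "\<And>b. b \<ge> a \<Longrightarrow> inf z (j b) \<le> k b" for z a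
    unfolding h_def using that by (auto intro: Sup_upper)
  have h_le: "inf (j b) (h a) \<le> k b" if "b \<ge> a" for a b
    unfolding h_def inf_Sup_frame using that by (auto intro!: SUP_least simp: inf.commute)
  show "inf (j a) (h a) \<le> k a" for a by (rule h_le) simp
  have h_mono: "h a \<le> h b" if "a \<le> b" for a b
    unfolding h_def using that by (intro Sup_subset_mono) (auto intro: order_trans)
  show "is_nucleus h"
  proof (rule is_nucleusI)
    fix a b :: 'a
    show "a \<le> h a"
    proof (rule le_h)
      fix b assume "a \<le> b"
      then show "inf a (j b) \<le> k b" using K by (meson le_infI1 order_trans)
    qed
    show "h a \<le> h b" if "a \<le> b" using that by (rule h_mono)
    show "inf (h a) (h b) \<le> h (inf a b)"
    proof (rule le_h)
      fix c assume c: "inf a b \<le> c"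
      have *: "inf (h x) (j c) \<le> k (sup x c)" for x
      proof -
        have "inf (h x) (j c) \<le> inf (j (sup x c)) (h x)"
          using is_nucleus_mono[OF j, of c "sup x c"] by (simp add: le_infI2)
        also have "\<dots> \<le> k (sup x c)" by (rule h_le) simp
        finally show ?thesis .
      qed
      have "inf (inf (h a) (h b)) (j c) \<le> inf (inf (h a) (j c)) (inf (h b) (j c))"
        by (simp add: le_infI1)
      also have "\<dots> \<le> inf (k (sup a c)) (k (sup b c))"
        by (rule inf_mono[OF * *])
      also have "\<dots> = k (inf (sup a c) (sup b c))" using K by simp
      also have "\<dots> \<le> k c"
        by (rule is_nucleus_mono[OF k])
          (use frame_sup_inf_distrib[of a c b] c in \<open>simp add: sup.absorb2\<close>)
      finally show "inf (inf (h a) (h b)) (j c) \<le> k c" .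
    qed
    show "h (h a) \<le> h a"
    proof (rule le_h)
      fix b assume ab: "a \<le> b"
      have bh: "b \<le> h b"
        by (rule le_h) (use K in \<open>meson le_infI1 order_trans\<close>)
      have "inf (h (h a)) (j b) \<le> inf (j (h b)) (h (h a))"
        using is_nucleus_mono[OF j bh] by (simp add: le_infI2)
      also have "\<dots> \<le> k (h b)" by (rule h_le) (rule h_mono[OF ab])
      finally have "inf (h (h a)) (j b) \<le> inf (k (h b)) (k (j b))"
        using K by (meson le_infI2 le_inf_iff)
      also have "\<dots> = k (inf (j b) (h b))" using K by (simp add: inf.commute)
      also have "\<dots> \<le> k (k b)" by (rule is_nucleus_mono[OF k h_le]) simp
      also have "\<dots> \<le> k b" using K by simp
      finally show "inf (h (h a)) (j b) \<le> k b" .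
    qed
  qed
qed

instance nucleus :: (frame) frame
proof
  fix j :: "'a nucleus" and S :: "'a nucleus set"
  define k where "k = (SUP s\<in>S. inf j s)"
  let ?J = "app_nucleus j" and ?K = "app_nucleus k"
  let ?h = "\<lambda>a. Sup {z. \<forall>b\<ge>a. inf z (?J b) \<le> ?K b}"
  have nuc: "is_nucleus (app_nucleus x)" for x :: "'a nucleus"
    using app_nucleus by simp
  note h = is_nucleus_imp[OF nuc[of j] nuc[of k]]
  have app_h: "app_nucleus (Nucleus ?h) = ?h"
    using h(1) by (simp add: Nucleus_inverse)
  have "Sup S \<le> Nucleus ?h"
  proof (rule Sup_least)
    fix s assume "s \<in> S"
    then have "inf j s \<le> k" unfolding k_def by (rule SUP_upper)
    then have *: "inf (?J b) (app_nucleus s b) \<le> ?K b" for b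
      by (simp add: less_eq_nucleus.rep_eq app_inf_nucleus)
    have "app_nucleus s a \<le> ?h a" for a
    proof (rule Sup_upper, safe)
      fix b assume "a \<le> b"
      then have "inf (app_nucleus s a) (?J b) \<le> inf (?J b) (app_nucleus s b)"
        using is_nucleus_mono[OF nuc[of s]] by (simp add: le_infI1)
      then show "inf (app_nucleus s a) (?J b) \<le> ?K b" using * by (rule order_trans)
    qed
    then show "s \<le> Nucleus ?h" by (simp add: less_eq_nucleus.rep_eq app_h)
  qed
  then have "inf j (Sup S) \<le> inf j (Nucleus ?h)" by (simp add: le_infI2)
  also have "\<dots> \<le> k"
    using h(2) by (simp add: less_eq_nucleus.rep_eq app_inf_nucleus app_h)
  finally have "inf j (Sup S) \<le> k" .
  moreover have "k \<le> inf j (Sup S)"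
    unfolding k_def by (auto intro!: SUP_least intro: le_infI2 Sup_upper)
  ultimately show "inf j (Sup S) = (SUP s\<in>S. inf j s)" unfolding k_def by (rule antisym)
qed

end

(* Points of a frame correspond to its meet-prime elements, so it suffices to match the meet-primes
   of L with those of N(L). A meet-prime m of L is sent to the nucleus w with w x = m for x \<le> m and
   w x = top otherwise; j \<le> w holds iff j m \<le> m, which makes w meet-prime. Conversely, a meet-prime
   nucleus k is the one attached to k bot: for each a the closed nucleus (sup a) and the open
   nucleus of a have infimum bot, so one of them is below k; hence a \<le> k bot or k a = top. *)
theory Submission
  imports Defs
begin

definition meet_prime :: "'a::complete_lattice \<Rightarrow> bool" where
  "meet_prime m \<longleftrightarrow> m \<noteq> top \<and> (\<forall>a b. inf a b \<le> m \<longrightarrow> a \<le> m \<or> b \<le> m)"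

lemma meet_primeD: "meet_prime m \<Longrightarrow> inf a b \<le> m \<Longrightarrow> a \<le> m \<or> b \<le> m"
  by (simp add: meet_prime_def)

text \<open>Joins are preserved for every m, because a join lies below m exactly when all its
  members do. So only finite meets matter: the empty one excludes \<open>m = top\<close>, the binary
  ones give primeness, and induction covers the rest.\<close>

lemma frame_hom_not_le_iff: "frame_hom (\<lambda>a. \<not> a \<le> m) \<longleftrightarrow> meet_prime (m::'a::frame)"
proof
  assume h: "frame_hom (\<lambda>a. \<not> a \<le> m)"
  then have fin: "(\<not> Inf A \<le> m) = Inf ((\<lambda>a. \<not> a \<le> m) ` A)" if "finite A" for A
    using that unfolding frame_hom_def by blast
  show "meet_prime m"
    unfolding meet_prime_def
  proof (intro conjI allI impI)
    show "m \<noteq> top" using fin[of "{}"] by auto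
    show "a \<le> m \<or> b \<le> m" if "inf a b \<le> m" for a b
      using fin[of "{a, b}"] that by auto
  qed
next
  assume m: "meet_prime m"
  have "(\<not> Inf A \<le> m) = Inf ((\<lambda>a. \<not> a \<le> m) ` A)" if "finite A" for A
    using that
  proof induction
    case empty
    then show ?case using m by (simp add: meet_prime_def top_unique)
  next
    case (insert a A)
    have "inf a (Inf A) \<le> m \<longleftrightarrow> a \<le> m \<or> Inf A \<le> m"
      using m by (auto simp: meet_prime_def intro: le_infI1 le_infI2)
    then show ?case using insert.IH by auto
  qed
  then show "frame_hom (\<lambda>a. \<not> a \<le> m)"
    by (auto simp: frame_hom_def Sup_le_iff)
qed

text \<open>The kernel of a point is closed under arbitrary joins and downward closed, hence is the
  principal ideal of its own join.\<close>

lemma frame_hom_eq_not_le: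
  fixes p :: "'a::frame \<Rightarrow> bool"
  assumes "frame_hom p"
  shows "p = (\<lambda>a. \<not> a \<le> Sup {x. \<not> p x})"
proof
  fix a
  let ?m = "Sup {x. \<not> p x}"
  have sup: "p (Sup S) \<longleftrightarrow> (\<exists>s\<in>S. p s)" for S
    using assms by (simp add: frame_hom_def)
  have "\<not> p ?m" by (simp add: sup)
  \<comment> \<open>Preservation of the join of this pair, which is \<open>?m\<close>, supplies
    monotonicity of p.\<close>
  moreover have "p ?m" if "p a" "a \<le> ?m"
    using sup[of "{a, ?m}"] that by (simp add: sup.absorb2)
  ultimately show "p a = (\<not> a \<le> ?m)" by (auto intro: Sup_upper)
qed

lemma bij_betw_meet_prime_pt:
  "bij_betw (\<lambda>m a. \<not> a \<le> m) {m::'a::frame. meet_prime m} (pt :: ('a \<Rightarrow> bool) set)"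
  unfolding bij_betw_def
proof
  show "inj_on (\<lambda>m a. \<not> a \<le> m) {m::'a. meet_prime m}"
  proof (rule inj_onI)
    fix m n :: 'a
    assume "(\<lambda>a. \<not> a \<le> m) = (\<lambda>a. \<not> a \<le> n)"
    then have "a \<le> m \<longleftrightarrow> a \<le> n" for a by meson
    then show "m = n" by (meson antisym order_refl)
  qed
  show "(\<lambda>m a. \<not> a \<le> m) ` {m::'a. meet_prime m} = pt"
  proof (intro equalityI subsetI)
    fix p :: "'a \<Rightarrow> bool" assume "p \<in> (\<lambda>m a. \<not> a \<le> m) ` {m. meet_prime m}"
    then show "p \<in> pt" by (auto simp: pt_def frame_hom_not_le_iff)
  next
    fix p :: "'a \<Rightarrow> bool" assume "p \<in> pt"
    then have "frame_hom p" by (simp add: pt_def)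
    note eq = frame_hom_eq_not_le[OF this]
    have "meet_prime (Sup {x. \<not> p x})"
      using \<open>frame_hom p\<close> eq frame_hom_not_le_iff by metis
    with eq show "p \<in> (\<lambda>m a. \<not> a \<le> m) ` {m. meet_prime m}" by blast
  qed
qed

lemma is_nucleus_app [simp]: "is_nucleus (app_nucleus j)"
  using app_nucleus by simp

lemma le_app_nucleus: "a \<le> app_nucleus j a"
  using is_nucleus_app[of j] by (simp add: is_nucleus_def)

lemma app_nucleus_idem_le: "app_nucleus j (app_nucleus j a) \<le> app_nucleus j a"
  using is_nucleus_app[of j] by (simp add: is_nucleus_def)

lemma app_nucleus_mono: "a \<le> b \<Longrightarrow> app_nucleus j a \<le> app_nucleus j b"
  by (rule is_nucleus_mono) simp_all

lemma app_top_nucleus: "app_nucleus top a = top"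
  unfolding top_nucleus_def by transfer simp

lemma is_nucleus_sup: "is_nucleus (sup (a::'a::frame))"
proof (rule is_nucleusI)
  fix x y :: 'a
  show "inf (sup a x) (sup a y) \<le> sup a (inf x y)"
    using frame_sup_inf_distrib[of x a y] by (simp add: sup.commute)
qed (auto intro: le_supI2)

lift_definition closed_nucleus :: "'a::frame \<Rightarrow> 'a nucleus" is sup
  by (rule is_nucleus_sup)

text \<open>The closed nuclei embed L into N(L), and evaluation at \<open>bot\<close> is the right
  adjoint. This moves primeness of k down to \<open>app_nucleus k bot\<close>.\<close>

lemma closed_nucleus_le_iff: "closed_nucleus a \<le> k \<longleftrightarrow> a \<le> app_nucleus k bot"
proof
  assume "closed_nucleus a \<le> k"
  then have "sup a bot \<le> app_nucleus k bot"
    by (simp only: less_eq_nucleus.rep_eq closed_nucleus.rep_eq)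
  then show "a \<le> app_nucleus k bot" by simp
next
  assume "a \<le> app_nucleus k bot"
  then have "a \<le> app_nucleus k x" for x
    using app_nucleus_mono[of bot x k] by (meson bot_least order_trans)
  then show "closed_nucleus a \<le> k"
    by (simp add: less_eq_nucleus.rep_eq closed_nucleus.rep_eq le_app_nucleus)
qed

lemma inf_closed_nucleus_le:
  "inf (closed_nucleus a) (closed_nucleus b) \<le> closed_nucleus (inf a b)"
  by (simp add: less_eq_nucleus.rep_eq closed_nucleus.rep_eq app_inf_nucleus frame_sup_inf_distrib)

text \<open>The witness is the open nucleus \<open>a \<rightarrow> _\<close>, obtained as the Heyting implication from the closed
  nucleus to the identity.\<close>

lemma ex_open_nucleus:
  fixes a :: "'a::frame"
  obtains h where "app_nucleus h a = top" and "\<And>k. inf (closed_nucleus a) h \<le> k"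
proof -
  define h where "h = (\<lambda>x. Sup {z. \<forall>b\<ge>x. inf z (sup a b) \<le> id b})"
  have id: "is_nucleus (id :: 'a \<Rightarrow> 'a)" by (simp add: is_nucleus_def)
  note H = is_nucleus_imp[OF is_nucleus_sup[of a] id, folded h_def]
  have app: "app_nucleus (Nucleus h) = h" using H(1) by (simp add: Nucleus_inverse)
  show ?thesis
  proof
    \<comment> \<open>For b above a, \<open>sup a b\<close> is b itself, so \<open>top\<close>
      belongs to the set whose join is \<open>h a\<close>.\<close>
    have "top \<le> h a" unfolding h_def by (rule Sup_upper) (simp add: sup.absorb2)
    then show "app_nucleus (Nucleus h) a = top" by (simp add: app top_le)
    show "inf (closed_nucleus a) (Nucleus h) \<le> k" for k
    proof -
      have "inf (sup a x) (h x) \<le> app_nucleus k x" for x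
        using H(2)[of x] unfolding h_def id_apply by (rule order_trans[OF _ le_app_nucleus])
      then show ?thesis
        by (simp add: less_eq_nucleus.rep_eq closed_nucleus.rep_eq app_inf_nucleus app)
    qed
  qed
qed

text \<open>For m that is not meet-prime the function may fail to be a nucleus, and then
  \<open>Nucleus\<close> returns an unspecified value; hence the assumption in the lemmas
  below.\<close>

definition prime_nucleus :: "'a::frame \<Rightarrow> 'a nucleus" where
  "prime_nucleus m = Nucleus (\<lambda>a. if a \<le> m then m else top)"

lemma app_prime_nucleus:
  assumes "meet_prime m"
  shows "app_nucleus (prime_nucleus m) a = (if a \<le> m then m else top)"
proof -
  have "is_nucleus (\<lambda>a. if a \<le> m then m else top)"
    using assms
    by (intro is_nucleusI) (auto simp: meet_prime_def top_le intro: order_trans)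
  then show ?thesis unfolding prime_nucleus_def by (simp add: Nucleus_inverse)
qed

text \<open>Only arguments below m impose a condition, and by monotonicity of j the strongest of
  these conditions is the one at m.\<close>

lemma le_prime_nucleus_iff:
  assumes "meet_prime m"
  shows "j \<le> prime_nucleus m \<longleftrightarrow> app_nucleus j m \<le> m"
  unfolding less_eq_nucleus.rep_eq app_prime_nucleus[OF assms]
  by (auto intro: order_trans[OF app_nucleus_mono])

lemma meet_prime_prime_nucleus:
  assumes "meet_prime m"
  shows "meet_prime (prime_nucleus m)"
  unfolding meet_prime_def
proof (intro conjI allI impI)
  have "m \<noteq> top" using assms by (simp add: meet_prime_def)
  then show "prime_nucleus m \<noteq> top"
    using app_prime_nucleus[OF assms, of m] by (auto simp: app_top_nucleus)
  show "j \<le> prime_nucleus m \<or> k \<le> prime_nucleus m" if "inf j k \<le> prime_nucleus m" for j k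
    using that assms by (auto simp: le_prime_nucleus_iff app_inf_nucleus meet_prime_def)
qed

lemma meet_prime_app_bot:
  assumes "meet_prime k"
  shows "meet_prime (app_nucleus k bot)"
  unfolding meet_prime_def
proof (intro conjI allI impI)
  show "app_nucleus k bot \<noteq> top"
  proof
    assume "app_nucleus k bot = top"
    then have "app_nucleus k a = top" for a
      using app_nucleus_mono[of bot a k] by (simp add: top_le)
    then have "top \<le> k" by (simp add: less_eq_nucleus.rep_eq)
    then show False using assms by (simp add: meet_prime_def top_unique)
  qed
  fix a b assume "inf a b \<le> app_nucleus k bot"
  then have "closed_nucleus (inf a b) \<le> k" by (simp only: closed_nucleus_le_iff)
  with inf_closed_nucleus_le have "inf (closed_nucleus a) (closed_nucleus b) \<le> k"
    by (rule order_trans)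
  then show "a \<le> app_nucleus k bot \<or> b \<le> app_nucleus k bot"
    using meet_primeD[OF assms] by (simp only: closed_nucleus_le_iff[symmetric])
qed

lemma prime_nucleus_app_bot:
  assumes k: "meet_prime k"
  shows "prime_nucleus (app_nucleus k bot) = k"
proof (rule antisym)
  note m = meet_prime_app_bot[OF k]
  show "k \<le> prime_nucleus (app_nucleus k bot)"
    \<comment> \<open>The criterion asks only that k map its value at \<open>bot\<close> below
      itself, which is idempotence.\<close>
    by (simp add: le_prime_nucleus_iff[OF m] app_nucleus_idem_le)
  have "app_nucleus k a = top" if a: "\<not> a \<le> app_nucleus k bot" for a
  proof -
    obtain h where h: "app_nucleus h a = top" "inf (closed_nucleus a) h \<le> k"
      by (rule ex_open_nucleus[of a]) blast
    \<comment> \<open>Since k is prime, it lies above the closed or the open nucleus of a; the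
      closed one is excluded by the assumption on a.\<close>
    have "h \<le> k" using meet_primeD[OF k h(2)] a by (simp add: closed_nucleus_le_iff)
    then show ?thesis using h(1) by (metis less_eq_nucleus.rep_eq top_le)
  qed
  then show "prime_nucleus (app_nucleus k bot) \<le> k"
    by (simp add: less_eq_nucleus.rep_eq app_prime_nucleus[OF m] app_nucleus_mono)
qed

text \<open>Evaluation at \<open>bot\<close> is the inverse: as \<open>bot\<close> lies below m, the
  nucleus of m takes the value m there.\<close>

lemma bij_betw_prime_nucleus:
  "bij_betw prime_nucleus {m::'a::frame. meet_prime m} {k. meet_prime k}"
  by (rule bij_betw_byWitness[where f' = "\<lambda>k. app_nucleus k bot"])
    (auto simp: app_prime_nucleus prime_nucleus_app_bot meet_prime_prime_nucleus meet_prime_app_bot)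

theorem proposition5p8:
  "\<exists>f. bij_betw f (pt :: ('a::frame \<Rightarrow> bool) set) (pt :: ('a nucleus \<Rightarrow> bool) set)"
  using bij_betw_trans[OF bij_betw_inv_into[OF bij_betw_meet_prime_pt]
      bij_betw_trans[OF bij_betw_prime_nucleus bij_betw_meet_prime_pt]]
  by blast

end
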